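(* Let $\Gamma(N)$ be a parking spot selection game with $N>1$ drivers, $R\geq 1$ public spots and cost parameters $1<\beta<\gamma$, and let $\delta=\gamma-\beta$ and $\sigma_0=\frac{R(\gamma-1)}{\delta}\in\mathbb{R}$. Let $\sigma_{pub}(a)$ denote the number of drivers playing $public$ in the action profile $a$. Then the set of pure Nash equilibria of $\Gamma(N)$ is as follows: (1) if $N\leq\sigma_0$, there is exactly one Nash equilibrium $a^*$, and it satisfies $\sigma_{pub}(a^* )=N$; (2) if $N>\sigma_0$ and $\sigma_0\in(R,N)\setminus\mathbb{N}^*$, there are exactly $\binom{N}{\lfloor\sigma_0\rfloor}$ Nash equilibrium profiles $a'$, namely those with $\sigma_{pub}(a')=\lfloor\sigma_0\rfloor$; (3) if $N>\sigma_0$ and $\sigma_0\in[R+1,N]\cap\mathbb{N}^*$, the Nash equilibria are exactly the $\binom{N}{\sigma_0}$ profiles $a'$ with $\sigma_{pub}(a')=\sigma_0$ together with the $\binom{N}{\sigma_0-1}$ profiles $a^\star$ with $\sigma_{pub}(a^\star)=\sigma_0-1$.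
   Context: Parking spot selection game $\Gamma(N)$: there is a set $\mathcal{N}=\{1,\dots,N\}$ of $N>1$ drivers, $R\geq 1$ public parking spots (an integer), and at least $N$ private spots. Each driver $i$ has action set $A_i=\{public, private\}$. Fix $c_{pub,s}>0$ and reals $1<\beta<\gamma$; put $c_{pub,f}=\gamma c_{pub,s}$, $c_{priv}=\beta c_{pub,s}$, $\delta=\gamma-\beta>0$. If $k\ge 1$ drivers in total play $public$, each of them incurs the (expected) cost $$w_{pub}(k)=\min(1,R/k)\,c_{pub,s}+(1-\min(1,R/k))\,c_{pub,f},$$ and each driver playing $private$ incurs the constant cost $c_{priv}$. For an action profile $a\in\{public,private\}^N$, let $\sigma_{pub}(a)$ be the number of drivers playing $public$; the cost $c_i^N(a)$ of driver $i$ is $w_{pub}(\sigma_{pub}(a))$ if $a_i=public$ and $c_{priv}$ if $a_i=private$. Drivers are cost minimizers. A profile $a=(a_i,a_{-i})$ is a (pure) Nash equilibrium if for every $i$, $a_i\in\arg\min_{a_i'\in A_i}c_i^N(a_i',a_{-i})$. $\mathbb{N}^*$ denotes the positive integers.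
   Formalization: Item (1) is proved for N < σ_0 instead of N ≤ σ_0, and item (3) for N ≥ σ_0 instead of N > σ_0, because at N = σ_0 the profiles with σ_pub = N−1 are also Nash equilibria, so the uniqueness claimed in (1) fails there. *)

theory Defs
  imports Complex_Main "HOL-Library.FuncSet"
begin

datatype action = Public | Private

text \<open>Action profiles of the drivers \<open>1, \<dots>, N\<close>. They are extensional functions, so that
  distinct profiles differ on some driver and profiles can be counted.\<close>

definition profiles :: "nat \<Rightarrow> (nat \<Rightarrow> action) set" where
  "profiles N = {1..N} \<rightarrow>\<^sub>E UNIV"

definition sigma_pub :: "nat \<Rightarrow> (nat \<Rightarrow> action) \<Rightarrow> nat" where
  "sigma_pub N a = card {i \<in> {1..N}. a i = Public}"

text \<open>In the following, \<open>R\<close> is the number of public spots, \<open>c\<close> the cost of a successful search for a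
  public spot, \<open>\<gamma> * c\<close> the cost of a failed one and \<open>\<beta> * c\<close> the cost of a private spot. There are
  enough private spots for all drivers, so their number does not enter the costs.
  The value \<open>w_pub R c \<gamma> 0\<close> is never used as a driver's cost.\<close>

definition w_pub :: "nat \<Rightarrow> real \<Rightarrow> real \<Rightarrow> nat \<Rightarrow> real" where
  "w_pub R c \<gamma> k =
     min 1 (real R / real k) * c + (1 - min 1 (real R / real k)) * (\<gamma> * c)"

definition cost :: "nat \<Rightarrow> nat \<Rightarrow> real \<Rightarrow> real \<Rightarrow> real \<Rightarrow> (nat \<Rightarrow> action) \<Rightarrow> nat \<Rightarrow> real" where
  "cost N R c \<beta> \<gamma> a i =
     (case a i of Public \<Rightarrow> w_pub R c \<gamma> (sigma_pub N a) | Private \<Rightarrow> \<beta> * c)"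

definition nash_equilibria :: "nat \<Rightarrow> nat \<Rightarrow> real \<Rightarrow> real \<Rightarrow> real \<Rightarrow> (nat \<Rightarrow> action) set" where
  "nash_equilibria N R c \<beta> \<gamma> =
     {a \<in> profiles N. \<forall>i \<in> {1..N}.
        is_arg_min (\<lambda>x. cost N R c \<beta> \<gamma> (a(i := x)) i) (\<lambda>x. x \<in> UNIV) (a i)}"

end

theory Submission
  imports Defs
begin

text \<open>The threshold \<open>\<sigma>\<^sub>0\<close> is the real congestion level at which a public spot costs as much as a
  private one. Hence a driver on a public spot is content iff at most \<open>\<sigma>\<^sub>0\<close> drivers are public, and a
  driver on a private spot is content iff one more public driver would raise the load to at least
  \<open>\<sigma>\<^sub>0\<close>. Whether a profile is an equilibrium thus depends only on its number \<open>k\<close> of public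
  drivers: it is one iff \<open>k \<le> \<sigma>\<^sub>0\<close> and either \<open>k = N\<close> or \<open>\<sigma>\<^sub>0 \<le> k + 1\<close>.\<close>

text \<open>In the congested regime the minimum is \<open>R / k\<close>, and the difference of costs
  is \<open>c * (\<gamma> - \<beta>) - c * R * (\<gamma> - 1) / k\<close>. Pulling out
  \<open>c * (\<gamma> - \<beta>) / k\<close> exposes the threshold as its only zero when
  \<open>c > 0\<close>, so the sign can be read off.\<close>

lemma w_pub_minus_private:
  assumes "R < k" "\<beta> < \<gamma>"
  shows "w_pub R c \<gamma> k - \<beta> * c = c * (\<gamma> - \<beta>) / real k * (real k - real R * (\<gamma> - 1) / (\<gamma> - \<beta>))"
proof -
  have "min 1 (real R / real k) = real R / real k"
    using assms by (simp add: field_simps)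
  then show ?thesis
    using assms unfolding w_pub_def by (simp add: field_simps)
qed

text \<open>Since \<beta> > 1, the factor \<open>(\<gamma> - 1) / (\<gamma> - \<beta>)\<close>
  exceeds 1. Loads without congestion therefore lie strictly below the threshold, and the threshold
  is positive.\<close>

lemma R_less_threshold:
  assumes "R \<ge> 1" "1 < \<beta>" "\<beta> < \<gamma>"
  shows "real R < real R * (\<gamma> - 1) / (\<gamma> - \<beta>)"
  using assms by (simp add: pos_less_divide_eq)

lemma w_pub_no_congestion:
  assumes "1 \<le> k" "k \<le> R"
  shows "w_pub R c \<gamma> k = c"
  using assms by (simp add: w_pub_def min_def)

text \<open>Up to load \<open>R\<close> both comparisons are strict and agree; beyond
  \<open>R\<close> the factored difference decides. Both weak inequalities are recorded because an
  indifferent driver is content with either action.\<close>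

lemma w_pub_compare_private:
  assumes "R \<ge> 1" "c > 0" "1 < \<beta>" "\<beta> < \<gamma>" "k \<ge> 1"
  shows w_pub_le_private_iff: "w_pub R c \<gamma> k \<le> \<beta> * c \<longleftrightarrow> real k \<le> real R * (\<gamma> - 1) / (\<gamma> - \<beta>)"
    and private_le_w_pub_iff: "\<beta> * c \<le> w_pub R c \<gamma> k \<longleftrightarrow> real R * (\<gamma> - 1) / (\<gamma> - \<beta>) \<le> real k"
proof -
  let ?s = "real R * (\<gamma> - 1) / (\<gamma> - \<beta>)"
  have "(w_pub R c \<gamma> k \<le> \<beta> * c \<longleftrightarrow> real k \<le> ?s) \<and> (\<beta> * c \<le> w_pub R c \<gamma> k \<longleftrightarrow> ?s \<le> real k)"
  proof (cases "k \<le> R")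
    case True
    then have "real k < ?s"
      using R_less_threshold[of R \<beta> \<gamma>] assms by linarith
    moreover have "w_pub R c \<gamma> k < \<beta> * c"
      using assms True by (simp add: w_pub_no_congestion)
    ultimately show ?thesis by linarith
  next
    case False
    define q where "q = c * (\<gamma> - \<beta>) / real k"
    have "q > 0" using assms by (simp add: q_def)
    moreover have "w_pub R c \<gamma> k - \<beta> * c = q * (real k - ?s)"
      using w_pub_minus_private[of R k \<beta> \<gamma> c] False assms by (simp add: q_def)
    ultimately have "w_pub R c \<gamma> k - \<beta> * c \<le> 0 \<longleftrightarrow> real k - ?s \<le> 0"
      "0 \<le> w_pub R c \<gamma> k - \<beta> * c \<longleftrightarrow> 0 \<le> real k - ?s"
      by (auto simp: mult_le_0_iff zero_le_mult_iff)
    then show ?thesis by linarith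
  qed
  then show "w_pub R c \<gamma> k \<le> \<beta> * c \<longleftrightarrow> real k \<le> ?s" "\<beta> * c \<le> w_pub R c \<gamma> k \<longleftrightarrow> ?s \<le> real k"
    by blast+
qed

lemma sigma_pub_le: "sigma_pub N a \<le> N"
proof -
  have "card {i \<in> {1..N}. a i = Public} \<le> card {1..N}"
    by (rule card_mono) auto
  then show ?thesis by (simp add: sigma_pub_def)
qed

lemma sigma_pub_pos_iff: "0 < sigma_pub N a \<longleftrightarrow> (\<exists>i\<in>{1..N}. a i = Public)"
  by (auto simp: sigma_pub_def card_gt_0_iff)

lemma sigma_pub_eq_N_iff: "sigma_pub N a = N \<longleftrightarrow> (\<forall>i\<in>{1..N}. a i = Public)"
proof
  assume "sigma_pub N a = N"
  then have "{i \<in> {1..N}. a i = Public} = {1..N}"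
    by (intro card_subset_eq) (auto simp: sigma_pub_def)
  then show "\<forall>i\<in>{1..N}. a i = Public" by blast
next
  assume "\<forall>i\<in>{1..N}. a i = Public"
  then have "{i \<in> {1..N}. a i = Public} = {1..N}" by blast
  then show "sigma_pub N a = N" by (simp add: sigma_pub_def)
qed

lemma sigma_pub_upd_Public:
  assumes "i \<in> {1..N}" "a i = Private"
  shows "sigma_pub N (a(i := Public)) = Suc (sigma_pub N a)"
proof -
  have "{j \<in> {1..N}. (a(i := Public)) j = Public} = insert i {j \<in> {1..N}. a j = Public}"
    using assms(1) by auto
  then show ?thesis
    using assms by (simp add: sigma_pub_def)
qed

text \<open>With two actions, minimality is a single comparison with the other action. A public
  driver is judged at the current load, but a private one at the load that includes its own
  switch.\<close>

lemma content_iff: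
  "is_arg_min (\<lambda>x. cost N R c \<beta> \<gamma> (a(i := x)) i) (\<lambda>x. x \<in> UNIV) (a i) \<longleftrightarrow>
     (case a i of Public \<Rightarrow> w_pub R c \<gamma> (sigma_pub N a) \<le> \<beta> * c
      | Private \<Rightarrow> \<beta> * c \<le> w_pub R c \<gamma> (sigma_pub N (a(i := Public))))"
proof (cases "a i")
  case Public
  have "(\<forall>x. P x) \<longleftrightarrow> P Public \<and> P Private" for P
    by (metis action.exhaust)
  then show ?thesis
    using Public fun_upd_triv[of a i] by (simp add: is_arg_min_linorder cost_def)
next
  case Private
  have "(\<forall>x. P x) \<longleftrightarrow> P Public \<and> P Private" for P
    by (metis action.exhaust)
  then show ?thesis
    using Private by (simp add: is_arg_min_linorder cost_def)
qed

lemma nash_equilibria_eq: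
  assumes "R \<ge> 1" "c > 0" "1 < \<beta>" "\<beta> < \<gamma>"
    and s: "s = real R * (\<gamma> - 1) / (\<gamma> - \<beta>)"
  shows "nash_equilibria N R c \<beta> \<gamma> =
    {a \<in> profiles N. real (sigma_pub N a) \<le> s \<and> (sigma_pub N a = N \<or> s \<le> real (sigma_pub N a) + 1)}"
proof -
  have "(\<forall>i\<in>{1..N}. is_arg_min (\<lambda>x. cost N R c \<beta> \<gamma> (a(i := x)) i) (\<lambda>x. x \<in> UNIV) (a i)) \<longleftrightarrow>
      real (sigma_pub N a) \<le> s \<and> (sigma_pub N a = N \<or> s \<le> real (sigma_pub N a) + 1)" for a
  proof -
    let ?k = "sigma_pub N a"
    have content: "is_arg_min (\<lambda>x. cost N R c \<beta> \<gamma> (a(i := x)) i) (\<lambda>x. x \<in> UNIV) (a i) \<longleftrightarrow>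
        (case a i of Public \<Rightarrow> real ?k \<le> s | Private \<Rightarrow> s \<le> real ?k + 1)" if i: "i \<in> {1..N}" for i
    proof (cases "a i")
      case Public
      \<comment> \<open>Driver \<open>i\<close> itself makes the load positive. At load 0, division
        by zero would give \<open>w_pub\<close> the value \<open>\<gamma> * c\<close>, and the
        comparison with the threshold would fail.\<close>
      then have "?k \<ge> 1" using i sigma_pub_pos_iff[of N a] by auto
      then show ?thesis
        unfolding content_iff using Public w_pub_le_private_iff[of R c \<beta> \<gamma> ?k] assms by simp
    next
      case Private
      then show ?thesis
        unfolding content_iff
        using private_le_w_pub_iff[of R c \<beta> \<gamma> "Suc ?k"] assms sigma_pub_upd_Public[of i N a, OF i Private]
        by (simp add: add.commute)
    qed
    have "s > 0" using R_less_threshold[of R \<beta> \<gamma>] assms by linarith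
    have case_iff: "(case x of Public \<Rightarrow> P | Private \<Rightarrow> Q) \<longleftrightarrow> (x = Public \<longrightarrow> P) \<and> (x \<noteq> Public \<longrightarrow> Q)" for x P Q
      by (cases x) auto
    \<comment> \<open>Each condition depends on the driver only through its action, so it matters
      only whether some driver is public and whether some driver is private.\<close>
    have "(\<forall>i\<in>{1..N}. case a i of Public \<Rightarrow> real ?k \<le> s | Private \<Rightarrow> s \<le> real ?k + 1) \<longleftrightarrow>
        ((\<exists>i\<in>{1..N}. a i = Public) \<longrightarrow> real ?k \<le> s) \<and>
        (\<not> (\<forall>i\<in>{1..N}. a i = Public) \<longrightarrow> s \<le> real ?k + 1)"
      unfolding case_iff by blast
    also have "\<dots> \<longleftrightarrow> real ?k \<le> s \<and> (?k = N \<or> s \<le> real ?k + 1)"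
      unfolding sigma_pub_pos_iff[symmetric] sigma_pub_eq_N_iff[symmetric]
      using \<open>s > 0\<close> by (cases "?k = 0") auto
    finally show ?thesis using content by simp
  qed
  then show ?thesis unfolding nash_equilibria_def by blast
qed

text \<open>An extensional profile is determined by its set of public drivers, so these profiles
  correspond to the \<open>k\<close>-element subsets of \<open>{1..N}\<close>.\<close>

lemma card_profiles_sigma_pub: "card {a \<in> profiles N. sigma_pub N a = k} = N choose k"
proof -
  have "bij_betw (\<lambda>a. {i \<in> {1..N}. a i = Public})
      {a \<in> profiles N. sigma_pub N a = k} {B. B \<subseteq> {1..N} \<and> card B = k}"
  proof (rule bij_betw_byWitness[where
        f' = "\<lambda>B. restrict (\<lambda>i. if i \<in> B then Public else Private) {1..N}"])
    show "\<forall>a\<in>{a \<in> profiles N. sigma_pub N a = k}.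
        restrict (\<lambda>i. if i \<in> {i \<in> {1..N}. a i = Public} then Public else Private) {1..N} = a"
    proof
      fix a assume "a \<in> {a \<in> profiles N. sigma_pub N a = k}"
      then have a: "a \<in> extensional {1..N}" by (auto simp: profiles_def PiE_def)
      show "restrict (\<lambda>i. if i \<in> {i \<in> {1..N}. a i = Public} then Public else Private) {1..N} = a"
      proof (rule extensionalityI[OF restrict_extensional a])
        fix i assume "i \<in> {1..N}"
        then show "restrict (\<lambda>i. if i \<in> {i \<in> {1..N}. a i = Public} then Public else Private) {1..N} i = a i"
          by (cases "a i") auto
      qed
    qed
    have inverse: "{i \<in> {1..N}. restrict (\<lambda>i. if i \<in> B then Public else Private) {1..N} i = Public} = B"
      if "B \<subseteq> {1..N}" for B
      using that by (auto split: if_splits)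
    then show "\<forall>B\<in>{B. B \<subseteq> {1..N} \<and> card B = k}.
        {i \<in> {1..N}. restrict (\<lambda>i. if i \<in> B then Public else Private) {1..N} i = Public} = B"
      by blast
    show "(\<lambda>a. {i \<in> {1..N}. a i = Public}) ` {a \<in> profiles N. sigma_pub N a = k}
        \<subseteq> {B. B \<subseteq> {1..N} \<and> card B = k}"
      by (auto simp: sigma_pub_def)
    show "(\<lambda>B. restrict (\<lambda>i. if i \<in> B then Public else Private) {1..N}) `
        {B. B \<subseteq> {1..N} \<and> card B = k} \<subseteq> {a \<in> profiles N. sigma_pub N a = k}"
    proof clarify
      fix B assume "B \<subseteq> {1..N}" "k = card B"
      then show "restrict (\<lambda>i. if i \<in> B then Public else Private) {1..N} \<in> profiles N \<and>
          sigma_pub N (restrict (\<lambda>i. if i \<in> B then Public else Private) {1..N}) = card B"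
        unfolding sigma_pub_def inverse[OF \<open>B \<subseteq> {1..N}\<close>] profiles_def by simp
    qed
  qed
  then have "card {a \<in> profiles N. sigma_pub N a = k} = card {B. B \<subseteq> {1..N} \<and> card B = k}"
    by (rule bij_betw_same_card)
  also have "\<dots> = N choose k"
    using n_subsets[of "{1..N}" k] by simp
  finally show ?thesis .
qed

text \<open>At \<open>\<sigma>\<^sub>0 = N\<close> a lone private driver is indifferent, so profiles
  with \<open>N - 1\<close> public drivers are equilibria too. This boundary hence belongs to the
  third case, and the first has a strict inequality.\<close>

theorem theorem3p1:
  fixes N R :: nat and c \<beta> \<gamma> \<delta> \<sigma>\<^sub>0 :: real
  assumes "N > 1" and "R \<ge> 1" and "c > 0" and "1 < \<beta>" and "\<beta> < \<gamma>"
    and "\<delta> = \<gamma> - \<beta>" and "\<sigma>\<^sub>0 = real R * (\<gamma> - 1) / \<delta>"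
  shows
    "(real N < \<sigma>\<^sub>0 \<longrightarrow>
        (\<exists>!a. a \<in> nash_equilibria N R c \<beta> \<gamma>) \<and>
        (\<forall>a \<in> nash_equilibria N R c \<beta> \<gamma>. sigma_pub N a = N)) \<and>
     (real N > \<sigma>\<^sub>0 \<and> \<sigma>\<^sub>0 \<in> {real R<..<real N} - (\<nat> - {0}) \<longrightarrow>
        nash_equilibria N R c \<beta> \<gamma> = {a \<in> profiles N. int (sigma_pub N a) = \<lfloor>\<sigma>\<^sub>0\<rfloor>} \<and>
        card (nash_equilibria N R c \<beta> \<gamma>) = N choose nat \<lfloor>\<sigma>\<^sub>0\<rfloor>) \<and>
     (real N \<ge> \<sigma>\<^sub>0 \<and> \<sigma>\<^sub>0 \<in> {real R + 1..real N} \<inter> (\<nat> - {0}) \<longrightarrow>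
        nash_equilibria N R c \<beta> \<gamma> =
          {a \<in> profiles N. real (sigma_pub N a) = \<sigma>\<^sub>0} \<union>
          {a \<in> profiles N. real (sigma_pub N a) = \<sigma>\<^sub>0 - 1} \<and>
        card {a \<in> profiles N. real (sigma_pub N a) = \<sigma>\<^sub>0} = N choose nat \<lfloor>\<sigma>\<^sub>0\<rfloor> \<and>
        card {a \<in> profiles N. real (sigma_pub N a) = \<sigma>\<^sub>0 - 1} = N choose (nat \<lfloor>\<sigma>\<^sub>0\<rfloor> - 1))"
proof (intro conjI[where P = "_ \<longrightarrow> _"] impI)
  have s: "\<sigma>\<^sub>0 = real R * (\<gamma> - 1) / (\<gamma> - \<beta>)" using assms by simp
  have "\<sigma>\<^sub>0 > 0" using R_less_threshold[of R \<beta> \<gamma>] assms(2,4,5) s by linarith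
  note nash = nash_equilibria_eq[OF assms(2-5) s, of N]
  show "(\<exists>!a. a \<in> nash_equilibria N R c \<beta> \<gamma>) \<and> (\<forall>a \<in> nash_equilibria N R c \<beta> \<gamma>. sigma_pub N a = N)"
    if "real N < \<sigma>\<^sub>0"
  proof -
    \<comment> \<open>For \<open>k < N\<close> one has
      \<open>k + 1 \<le> N < \<sigma>\<^sub>0\<close>, so any private driver gains by
      switching.\<close>
    have "real k \<le> \<sigma>\<^sub>0 \<and> (k = N \<or> \<sigma>\<^sub>0 \<le> real k + 1) \<longleftrightarrow> k = N" if "k \<le> N" for k
      using that \<open>real N < \<sigma>\<^sub>0\<close> by (cases "k = N") auto
    then have eq: "nash_equilibria N R c \<beta> \<gamma> = {a \<in> profiles N. sigma_pub N a = N}"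
      unfolding nash using sigma_pub_le by blast
    \<comment> \<open>Existence and uniqueness both come from counting:
      \<open>N choose N = 1\<close>.\<close>
    then have "card (nash_equilibria N R c \<beta> \<gamma>) = 1"
      using card_profiles_sigma_pub[of N N] by simp
    then obtain b where "nash_equilibria N R c \<beta> \<gamma> = {b}"
      by (rule card_1_singletonE)
    moreover have "\<forall>a \<in> nash_equilibria N R c \<beta> \<gamma>. sigma_pub N a = N"
      unfolding eq by blast
    ultimately show ?thesis by simp
  qed
  show "nash_equilibria N R c \<beta> \<gamma> = {a \<in> profiles N. int (sigma_pub N a) = \<lfloor>\<sigma>\<^sub>0\<rfloor>} \<and>
      card (nash_equilibria N R c \<beta> \<gamma>) = N choose nat \<lfloor>\<sigma>\<^sub>0\<rfloor>"
    if A: "real N > \<sigma>\<^sub>0 \<and> \<sigma>\<^sub>0 \<in> {real R<..<real N} - (\<nat> - {0})"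
  proof -
    have not_nat: "\<sigma>\<^sub>0 \<noteq> real k" for k
      using A \<open>\<sigma>\<^sub>0 > 0\<close> by auto
    \<comment> \<open>The option \<open>k = N\<close> is excluded by
      \<open>N > \<sigma>\<^sub>0\<close>. As \<open>\<sigma>\<^sub>0\<close> is not an integer, the
      upper bound \<open>k + 1\<close> is strict, which characterizes the floor.\<close>
    have "real k \<le> \<sigma>\<^sub>0 \<and> (k = N \<or> \<sigma>\<^sub>0 \<le> real k + 1) \<longleftrightarrow> \<lfloor>\<sigma>\<^sub>0\<rfloor> = int k" for k
      using A not_nat[of "Suc k"] by (auto simp: floor_eq_iff)
    then have eq: "nash_equilibria N R c \<beta> \<gamma> = {a \<in> profiles N. int (sigma_pub N a) = \<lfloor>\<sigma>\<^sub>0\<rfloor>}"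
      unfolding nash by (simp add: eq_commute)
    also have "\<dots> = {a \<in> profiles N. sigma_pub N a = nat \<lfloor>\<sigma>\<^sub>0\<rfloor>}"
      using \<open>\<sigma>\<^sub>0 > 0\<close> by (auto simp: eq_nat_nat_iff)
    finally show ?thesis
      using eq by (simp add: card_profiles_sigma_pub)
  qed
  show "nash_equilibria N R c \<beta> \<gamma> =
          {a \<in> profiles N. real (sigma_pub N a) = \<sigma>\<^sub>0} \<union>
          {a \<in> profiles N. real (sigma_pub N a) = \<sigma>\<^sub>0 - 1} \<and>
        card {a \<in> profiles N. real (sigma_pub N a) = \<sigma>\<^sub>0} = N choose nat \<lfloor>\<sigma>\<^sub>0\<rfloor> \<and>
        card {a \<in> profiles N. real (sigma_pub N a) = \<sigma>\<^sub>0 - 1} = N choose (nat \<lfloor>\<sigma>\<^sub>0\<rfloor> - 1)"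
    if A: "real N \<ge> \<sigma>\<^sub>0 \<and> \<sigma>\<^sub>0 \<in> {real R + 1..real N} \<inter> (\<nat> - {0})"
  proof -
    obtain m where m: "\<sigma>\<^sub>0 = real m" using A by (auto elim: Nats_cases)
    have "m \<ge> 1" "m \<le> N" using A m by auto
    \<comment> \<open>An integral threshold makes both ends of
      \<open>\<sigma>\<^sub>0 - 1 \<le> k \<le> \<sigma>\<^sub>0\<close> attainable. The option
      \<open>k = N\<close> adds nothing, since \<open>N \<le> \<sigma>\<^sub>0\<close> and
      \<open>m \<le> N\<close> force \<open>k = m\<close>.\<close>
    have "real k \<le> \<sigma>\<^sub>0 \<and> (k = N \<or> \<sigma>\<^sub>0 \<le> real k + 1) \<longleftrightarrow> real k = \<sigma>\<^sub>0 \<or> real k = \<sigma>\<^sub>0 - 1" for k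
      using \<open>m \<le> N\<close> unfolding m by auto
    moreover have "real k = \<sigma>\<^sub>0 \<longleftrightarrow> k = m" "real k = \<sigma>\<^sub>0 - 1 \<longleftrightarrow> k = m - 1" for k
      using \<open>m \<ge> 1\<close> unfolding m by auto
    ultimately show ?thesis
      unfolding nash by (auto simp: m card_profiles_sigma_pub)
  qed
qed

end
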